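(* Let $\mathcal R$ be a minion, let $k\in\mathbb N$ ($k\ge 1$), and let $\mathcal D$ be a connected LC instance. Then the $k$-th saturated power $\mathrm{pow}_k\,\mathcal D$ has a solution in $\mathcal R$ if and only if $\mathcal D$ has a solution in the minion $\mathrm{lvl}_k\,\mathcal R$.
   Context: An LC (label cover) instance $\mathcal D$ consists of a finite set $X$ of variables, a finite set $\mathcal D_x$ (domain) for each $x\in X$, and a finite list of constraints of the form $x=\alpha(y)$ with $x,y\in X$ and $\alpha:\mathcal D_y\to\mathcal D_x$ a function. A solution is a tuple $(d_x)_{x\in X}$ with $d_x\in\mathcal D_x$ and $d_x=\alpha(d_y)$ for every constraint $x=\alpha(y)$. The shape of $\mathcal D$ is the directed multigraph with vertex set $X$ and an arc from $y$ to $x$ for each constraint $x=\alpha(y)$; $\mathcal D$ is connected if its shape is connected (as an undirected graph), and discrete if it has no constraints. A minion $\mathcal R$ is a functor from finite sets to sets: it assigns a set $\mathcal R^{(D)}$ to each finite set $D$ and a map $\mathcal R^{(\alpha)}:\mathcal R^{(D)}\to\mathcal R^{(E)}$ to each function $\alpha:D\to E$ between finite sets, with $\mathcal R^{(\mathrm{id}_D)}=\mathrm{id}$ and $\mathcal R^{(\alpha)}\circ\mathcal R^{(\beta)}=\mathcal R^{(\alpha\circ\beta)}$. A solution of $\mathcal D$ in $\mathcal R$ (equivalently, a solution of $\mathcal R\circ\mathcal D$) is a tuple $(r_x)_{x\in X}$ with $r_x\in\mathcal R^{(\mathcal D_x)}$ and $r_x=\mathcal R^{(\alpha)}(r_y)$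 for every constraint $x=\alpha(y)$ of $\mathcal D$. The $k$-th saturated power $\mathrm{pow}_k\,\mathcal D$ is the LC instance with variable set $X^k$, domains $\mathcal D_{x_1x_2\dots x_k}=\mathcal D_{x_1}\times\cdots\times\mathcal D_{x_k}$, and the following constraints, where first all constraints $x=\mathrm{id}(x)$ ($x\in X$) are added to $\mathcal D$: (1) for every $k$-tuple of constraints $x_i=\alpha_i(y_i)$, $i=1,\dots,k$, of $\mathcal D$, the constraint $x_1\dots x_k=(\alpha_1\times\cdots\times\alpha_k)(y_1\dots y_k)$; (2) for every $x_1\dots x_k\in X^k$ and every function $\sigma:[k]\to[k]$, the constraint $x_{\sigma(1)}\dots x_{\sigma(k)}=\sigma^*(x_1\dots x_k)$, where $\sigma^*(d_1\dots d_k)=d_{\sigma(1)}\dots d_{\sigma(k)}$. The $k$-th level $\mathrm{lvl}_k\,\mathcal R$ of $\mathcal R$ is the minion defined as follows. Elements of $(\mathrm{lvl}_k\,\mathcal R)^{(A)}$ are triples $(\mathcal E,r,\omega)$ where $\mathcal E$ is a discrete LC instance with variable set $Y$; $r=(r_{\bar y})_{\bar y\in Y^k}$ is a solution of $\mathrm{pow}_k\,\mathcal E$ in $\mathcal R$; and $\omega=(\omega_{\bar y})_{\bar y\in Y^{k-1}}$ is a tuple with $\omega_{\bar y}\in\mathcal R^{(A\times\mathcal E_{y_1}\times\cdots\times\mathcal E_{y_{k-1}})}$ such that there exist $z\in Y$ and a map $\beta:\mathcal E_z\to A$ with $\omega_{\bar y}=\mathcal R^{(\beta\times\mathrm{id}\times\cdots\times\mathrm{id})}(r_{zy_1\dots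 y_{k-1}})$ for all $\bar y\in Y^{k-1}$. For $\alpha:A\to B$, $(\mathrm{lvl}_k\,\mathcal R)^{(\alpha)}(\mathcal E,r,\omega)=(\mathcal E,r,\omega')$ with $\omega'_{\bar y}=\mathcal R^{(\alpha\times\mathrm{id}\times\cdots\times\mathrm{id})}(\omega_{\bar y})$. *)

theory Defs
  imports "HOL-Library.FuncSet" "Graph_Theory.Digraph_Component"
begin

section \<open>Finite sets and their products\<close>

text \<open>
  The finite sets of the theory (sets of variables, domains, arguments of minions) are the finite
  subsets of the following type. It contains sets of every finite cardinality and, for finite
  subsets \<open>A\<^sub>1, \<dots>, A\<^sub>n\<close>, also their product, as the set of the corresponding \<open>Tuple\<close>s. Products
  are flat: the factor \<open>A\<close> of \<open>A \<times> B\<^sub>1 \<times> \<dots> \<times> B\<^sub>n\<close> contributes one entry, just as each \<open>B\<^sub>i\<close> does,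
  and a product of a single set \<open>A\<close> consists of the 1-tuples over \<open>A\<close>.

  A map between two such sets \<open>A\<close> and \<open>B\<close> is an element of \<open>A \<rightarrow>\<^sub>E B\<close>, so that two maps are equal as
  soon as they agree on \<open>A\<close>. Families indexed by a set are represented in the same manner.
\<close>

datatype 'a obj = Atom 'a | Tuple (entries: "'a obj list")

definition prod_set :: "'a obj set list \<Rightarrow> 'a obj set" where
  "prod_set As = Tuple ` listset As"

definition prod_map :: "'a obj set list \<Rightarrow> ('a obj \<Rightarrow> 'a obj) list \<Rightarrow> 'a obj \<Rightarrow> 'a obj" where
  "prod_map As fs = (\<lambda>d\<in>prod_set As. Tuple (map2 (\<lambda>f. f) fs (entries d)))"

definition tuples :: "nat \<Rightarrow> 'a set \<Rightarrow> 'a list set" where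
  "tuples n X = {xs. length xs = n \<and> set xs \<subseteq> X}"


section \<open>Label cover instances\<close>

text \<open>The constraint \<open>x = \<alpha>(y)\<close> is \<open>Constr x \<alpha> y\<close>.\<close>

datatype 'a constr = Constr (lhs: "'a obj") (fn: "'a obj \<Rightarrow> 'a obj") (rhs: "'a obj")

record 'a lc =
  vars :: "'a obj set"
  vdom :: "'a obj \<Rightarrow> 'a obj set"
  constrs :: "'a constr list"

definition lc_instance :: "'a lc \<Rightarrow> bool" where
  "lc_instance D \<longleftrightarrow>
     finite (vars D) \<and>
     vdom D \<in> vars D \<rightarrow>\<^sub>E {A. finite A} \<and>
     (\<forall>c\<in>set (constrs D). lhs c \<in> vars D \<and> rhs c \<in> vars D \<and>
        fn c \<in> vdom D (rhs c) \<rightarrow>\<^sub>E vdom D (lhs c))"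

definition discrete :: "'a lc \<Rightarrow> bool" where
  "discrete D \<longleftrightarrow> constrs D = []"

definition shape :: "'a lc \<Rightarrow> ('a obj, nat) pre_digraph" where
  "shape D = \<lparr>verts = vars D, arcs = {..<length (constrs D)},
     tail = (\<lambda>i. rhs (constrs D ! i)), head = (\<lambda>i. lhs (constrs D ! i))\<rparr>"

text \<open>
  For digraphs, \<^const>\<open>connected\<close> refers to undirected paths, but it excludes the digraph without
  vertices. The instance without variables is counted as connected here.
\<close>

definition lc_connected :: "'a lc \<Rightarrow> bool" where
  "lc_connected D \<longleftrightarrow> vars D = {} \<or> connected (shape D)"


section \<open>Minions\<close>

text \<open>
  \<open>obs R D\<close> is \<open>R\<^sup>(\<^sup>D\<^sup>)\<close> and \<open>act R D E \<alpha>\<close> is \<open>R\<^sup>(\<^sup>\<alpha>\<^sup>)\<close> for \<open>\<alpha> : D \<rightarrow> E\<close>; the codomain has to be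
  given since it is not determined by \<open>\<alpha>\<close> as a HOL function. Only the values of \<open>obs\<close> and
  \<open>act\<close> at finite sets and at maps between them matter.
\<close>

record ('a, 'r) minion =
  obs :: "'a obj set \<Rightarrow> 'r set"
  act :: "'a obj set \<Rightarrow> 'a obj set \<Rightarrow> ('a obj \<Rightarrow> 'a obj) \<Rightarrow> 'r \<Rightarrow> 'r"

definition is_minion :: "('a, 'r) minion \<Rightarrow> bool" where
  "is_minion R \<longleftrightarrow>
     (\<forall>D E \<alpha>. finite D \<longrightarrow> finite E \<longrightarrow> \<alpha> \<in> D \<rightarrow>\<^sub>E E \<longrightarrow> act R D E \<alpha> \<in> obs R D \<rightarrow> obs R E) \<and>
     (\<forall>D. finite D \<longrightarrow> (\<forall>r\<in>obs R D. act R D D (\<lambda>d\<in>D. d) r = r)) \<and>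
     (\<forall>C D E \<alpha> \<beta>. finite C \<longrightarrow> finite D \<longrightarrow> finite E \<longrightarrow> \<alpha> \<in> D \<rightarrow>\<^sub>E E \<longrightarrow> \<beta> \<in> C \<rightarrow>\<^sub>E D \<longrightarrow>
        (\<forall>r\<in>obs R C. act R D E \<alpha> (act R C D \<beta> r) = act R C E (compose C \<alpha> \<beta>) r))"

definition solution :: "('a, 'r) minion \<Rightarrow> 'a lc \<Rightarrow> ('a obj \<Rightarrow> 'r) \<Rightarrow> bool" where
  "solution R D r \<longleftrightarrow>
     r \<in> (\<Pi>\<^sub>E x\<in>vars D. obs R (vdom D x)) \<and>
     (\<forall>c\<in>set (constrs D).
        r (lhs c) = act R (vdom D (rhs c)) (vdom D (lhs c)) (fn c) (r (rhs c)))"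


section \<open>Saturated powers\<close>

text \<open>
  The constraints of an instance form a list, so listing those of a power requires some order on
  the set of variables. It only affects the order of the resulting list.
\<close>

definition enum :: "'a set \<Rightarrow> 'a list" where
  "enum X = (SOME xs. set xs = X \<and> distinct xs)"

definition id_constrs :: "'a lc \<Rightarrow> 'a constr list" where
  "id_constrs D = map (\<lambda>x. Constr x (\<lambda>d\<in>vdom D x. d) x) (enum (vars D))"

definition prod_constr :: "'a lc \<Rightarrow> 'a constr list \<Rightarrow> 'a constr" where
  "prod_constr D cs =
     Constr (Tuple (map lhs cs))
       (prod_map (map (\<lambda>c. vdom D (rhs c)) cs) (map fn cs))
       (Tuple (map rhs cs))"

text \<open>A function \<open>\<sigma> : [k] \<rightarrow> [k]\<close> is represented by the list \<open>s\<close> of its values, counted from 0.\<close>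

definition select_constr :: "'a lc \<Rightarrow> 'a obj list \<Rightarrow> nat list \<Rightarrow> 'a constr" where
  "select_constr D xs s =
     Constr (Tuple (map (\<lambda>i. xs ! i) s))
       (\<lambda>d\<in>prod_set (map (vdom D) xs). Tuple (map (\<lambda>i. entries d ! i) s))
       (Tuple xs)"

definition sat_pow :: "nat \<Rightarrow> 'a lc \<Rightarrow> 'a lc" where
  "sat_pow k D =
     \<lparr>vars = Tuple ` tuples k (vars D),
      vdom = (\<lambda>x\<in>Tuple ` tuples k (vars D). prod_set (map (vdom D) (entries x))),
      constrs =
        map (prod_constr D) (List.n_lists k (constrs D @ id_constrs D)) @
        [select_constr D xs s. xs \<leftarrow> List.n_lists k (enum (vars D)), s \<leftarrow> List.n_lists k [0..<k]]\<rparr>"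


section \<open>Levels of a minion\<close>

text \<open>
  For \<open>ys = [y\<^sub>1, \<dots>, y\<^sub>n]\<close>, the set \<open>A \<times> E\<^sub>y\<^sub>1 \<times> \<dots> \<times> E\<^sub>y\<^sub>n\<close>, and the function
  \<open>R\<^sup>(\<^sup>\<alpha> \<^sup>\<times> \<^sup>i\<^sup>d \<^sup>\<times> \<^sup>\<dots> \<^sup>\<times> \<^sup>i\<^sup>d\<^sup>)\<close> from \<open>R\<close> of this set to \<open>R\<close> of the set \<open>B \<times> E\<^sub>y\<^sub>1 \<times> \<dots> \<times> E\<^sub>y\<^sub>n\<close>, where \<open>\<alpha> : A \<rightarrow> B\<close>.
\<close>

definition ext_set :: "'a lc \<Rightarrow> 'a obj list \<Rightarrow> 'a obj set \<Rightarrow> 'a obj set" where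
  "ext_set E ys A = prod_set (A # map (vdom E) ys)"

definition ext_act :: "('a, 'r) minion \<Rightarrow> 'a lc \<Rightarrow> 'a obj list \<Rightarrow>
    'a obj set \<Rightarrow> 'a obj set \<Rightarrow> ('a obj \<Rightarrow> 'a obj) \<Rightarrow> 'r \<Rightarrow> 'r" where
  "ext_act R E ys A B \<alpha> =
     act R (ext_set E ys A) (ext_set E ys B)
       (prod_map (A # map (vdom E) ys) (\<alpha> # map (\<lambda>y. \<lambda>d\<in>vdom E y. d) ys))"

type_synonym ('a, 'r) lvl_obj = "'a lc \<times> ('a obj \<Rightarrow> 'r) \<times> ('a obj list \<Rightarrow> 'r)"

definition lvl :: "nat \<Rightarrow> ('a, 'r) minion \<Rightarrow> ('a, ('a, 'r) lvl_obj) minion" where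
  "lvl k R =
     \<lparr>obs = (\<lambda>A. {(E, r, \<omega>).
        lc_instance E \<and> discrete E \<and> solution R (sat_pow k E) r \<and>
        \<omega> \<in> (\<Pi>\<^sub>E ys\<in>tuples (k - 1) (vars E). obs R (ext_set E ys A)) \<and>
        (\<exists>z\<in>vars E. \<exists>\<beta>\<in>vdom E z \<rightarrow>\<^sub>E A. \<forall>ys\<in>tuples (k - 1) (vars E).
           \<omega> ys = ext_act R E ys (vdom E z) A \<beta> (r (Tuple (z # ys))))}),
      act = (\<lambda>A B \<alpha> (E, r, \<omega>).
        (E, r, \<lambda>ys\<in>tuples (k - 1) (vars E). ext_act R E ys A B \<alpha> (\<omega> ys)))\<rparr>"


section \<open>Saturated powers are instances and levels are minions\<close>

lemma in_listset_iff: "xs \<in> listset As \<longleftrightarrow> length xs = length As \<and> (\<forall>i<length As. xs ! i \<in> As ! i)"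
proof (induction As arbitrary: xs)
  case Nil then show ?case by auto
next
  case (Cons A As)
  show ?case
    by (cases xs) (auto simp: set_Cons_def Cons nth_Cons less_Suc_eq_0_disj split: nat.splits)
qed

lemma prod_set_iff: "d \<in> prod_set As \<longleftrightarrow> (\<exists>xs. d = Tuple xs \<and> length xs = length As \<and> (\<forall>i<length As. xs ! i \<in> As ! i))"
  by (auto simp: prod_set_def in_listset_iff)

lemma finite_prod_set: "(\<And>A. A \<in> set As \<Longrightarrow> finite A) \<Longrightarrow> finite (prod_set As)"
  unfolding prod_set_def
proof (rule finite_imageI, induction As)
  case (Cons A As)
  then have "finite A" "finite (listset As)" by auto
  then have "finite ((\<lambda>(x,xs). x # xs) ` (A \<times> listset As))" by blast
  then show ?case by (rule rev_finite_subset) (auto simp: set_Cons_def)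
qed auto

lemma finite_tuples: "finite X \<Longrightarrow> finite (tuples n X)"
  unfolding tuples_def using finite_lists_length_eq[of X n] by (simp add: conj_commute)

lemma prod_map_PiE:
  assumes "length fs = length As" "length Bs = length As" "\<And>i. i < length As \<Longrightarrow> fs ! i \<in> As ! i \<rightarrow>\<^sub>E Bs ! i"
  shows "prod_map As fs \<in> prod_set As \<rightarrow>\<^sub>E prod_set Bs"
proof
  fix d assume "d \<in> prod_set As"
  then obtain xs where d: "d = Tuple xs" "length xs = length As" "\<forall>i<length As. xs ! i \<in> As ! i" 
    by (auto simp: prod_set_iff)
  moreover from \<open>d \<in> _\<close> have "prod_map As fs d = Tuple (map2 (\<lambda>f. f) fs xs)"
    by (simp add: prod_map_def d)
  ultimately show "prod_map As fs d \<in> prod_set Bs"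
    using assms unfolding prod_set_iff by (intro exI[of _ "map2 (\<lambda>f. f) fs xs"]) (auto simp: PiE_mem)
qed (auto simp: prod_map_def)

lemma prod_map_compose:
  assumes "length fs = length As" "length Bs = length As" "length gs = length As" "length hs = length As"
     "\<And>i. i < length As \<Longrightarrow> fs ! i \<in> As ! i \<rightarrow>\<^sub>E Bs ! i"
     "\<And>i x. i < length As \<Longrightarrow> x \<in> As ! i \<Longrightarrow> (hs ! i) x = (gs ! i) ((fs ! i) x)"
  shows "compose (prod_set As) (prod_map Bs gs) (prod_map As fs) = prod_map As hs"
proof (rule ext)
  fix d
  show "compose (prod_set As) (prod_map Bs gs) (prod_map As fs) d = prod_map As hs d"
  proof (cases "d \<in> prod_set As")
    case True
    then obtain xs where d: "d = Tuple xs" "length xs = length As" "\<forall>i<length As. xs ! i \<in> As ! i" 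
      by (auto simp: prod_set_iff)
    have "prod_map As fs d \<in> prod_set Bs" using prod_map_PiE[OF assms(1,2,5)] True by auto
    moreover have "prod_map As fs d = Tuple (map2 (\<lambda>f. f) fs xs)"
      using True by (simp add: prod_map_def d)
    ultimately show ?thesis using True d assms
      by (auto simp: compose_def prod_map_def intro!: nth_equalityI)
  qed (simp add: compose_def prod_map_def)
qed

lemma prod_map_id:
  assumes "length fs = length As" "\<And>i x. i < length As \<Longrightarrow> x \<in> As ! i \<Longrightarrow> (fs ! i) x = x"
  shows "prod_map As fs = (\<lambda>d\<in>prod_set As. d)"
proof (rule ext)
  fix d show "prod_map As fs d = (\<lambda>d\<in>prod_set As. d) d"
    using assms by (cases "d \<in> prod_set As") (auto simp: prod_map_def prod_set_iff intro!: nth_equalityI)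
qed

lemma set_enum: "finite X \<Longrightarrow> set (enum X) = X"
  unfolding enum_def by (rule someI2_ex[OF finite_distinct_list]) auto

lemma set_constrs_sat_pow:
  assumes "finite (vars D)"
  shows "set (constrs (sat_pow k D)) =
    prod_constr D ` {cs. length cs = k \<and> set cs \<subseteq> set (constrs D @ id_constrs D)} \<union>
    (\<Union>xs\<in>{xs. length xs = k \<and> set xs \<subseteq> vars D}. select_constr D xs ` {s. length s = k \<and> set s \<subseteq> {0..<k}})"
  by (simp add: sat_pow_def set_n_lists set_enum[OF assms])

lemma lc_instance_sat_pow:
  assumes "lc_instance D"
  shows "lc_instance (sat_pow k D)"
proof -
  have fin: "finite (vars D)" and dom: "\<And>x. x \<in> vars D \<Longrightarrow> finite (vdom D x)"
    using assms by (auto simp: lc_instance_def)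
  let ?V = "Tuple ` tuples k (vars D)"
  have cs: "lhs c \<in> vars D \<and> rhs c \<in> vars D \<and> fn c \<in> vdom D (rhs c) \<rightarrow>\<^sub>E vdom D (lhs c)" 
    if "c \<in> set (constrs D @ id_constrs D)" for c
    using that assms by (auto simp: lc_instance_def id_constrs_def set_enum fin)
  have "lhs c \<in> ?V \<and> rhs c \<in> ?V \<and> fn c \<in> prod_set (map (vdom D) (entries (rhs c))) \<rightarrow>\<^sub>E prod_set (map (vdom D) (entries (lhs c)))"
    if c: "c \<in> set (constrs (sat_pow k D))" for c
  proof -
    consider (a) cs' where "length cs' = k" "set cs' \<subseteq> set (constrs D @ id_constrs D)" "c = prod_constr D cs'"
      | (b) xs s where "length xs = k" "set xs \<subseteq> vars D" "length s = k" "set s \<subseteq> {0..<k}" "c = select_constr D xs s"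
      using c unfolding set_constrs_sat_pow[OF fin] by blast
    then show ?thesis
    proof cases
      case a
      then have c': "\<And>c. c \<in> set cs' \<Longrightarrow> lhs c \<in> vars D \<and> rhs c \<in> vars D \<and> fn c \<in> vdom D (rhs c) \<rightarrow>\<^sub>E vdom D (lhs c)"
        using cs by blast
      have *: "lhs (cs' ! i) \<in> vars D \<and> rhs (cs' ! i) \<in> vars D \<and> fn (cs' ! i) \<in> vdom D (rhs (cs' ! i)) \<rightarrow>\<^sub>E vdom D (lhs (cs' ! i))"
          if "i < length cs'" for i by (rule c'[OF nth_mem[OF that]])
      have "prod_map (map (\<lambda>c. vdom D (rhs c)) cs') (map fn cs') \<in> prod_set (map (\<lambda>c. vdom D (rhs c)) cs') \<rightarrow>\<^sub>E prod_set (map (\<lambda>c. vdom D (lhs c)) cs')"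
        by (rule prod_map_PiE) (simp_all add: *)
      moreover have "set (map lhs cs') \<subseteq> vars D" "set (map rhs cs') \<subseteq> vars D" 
        using c' by auto
      ultimately show ?thesis using a(1)
        by (simp add: a(3) prod_constr_def tuples_def o_def)
    next
      case b
      have s: "s ! i < k" if "i < length s" for i using nth_mem[OF that] b(4) by auto
      have "xs ! i \<in> vars D" if "i \<in> set s" for i
      proof -
        have "i < length xs" using that b(1,4) by auto
        then have "xs ! i \<in> set xs" by (rule nth_mem)
        with b(2) show ?thesis by (rule subsetD)
      qed
      then have "set (map (\<lambda>i. xs ! i) s) \<subseteq> vars D" by auto
      moreover have "(\<lambda>d\<in>prod_set (map (vdom D) xs). Tuple (map (\<lambda>i. entries d ! i) s))
          \<in> prod_set (map (vdom D) xs) \<rightarrow>\<^sub>E prod_set (map (vdom D) (map (\<lambda>i. xs ! i) s))"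
      proof
        fix d assume "d \<in> prod_set (map (vdom D) xs)"
        moreover from this obtain ds where ds: "d = Tuple ds" "length ds = k" "\<And>i. i < k \<Longrightarrow> ds ! i \<in> vdom D (xs ! i)"
          using b(1) by (auto simp: prod_set_iff)
        moreover have "Tuple (map (\<lambda>i. ds ! i) s) \<in> prod_set (map (vdom D) (map (\<lambda>i. xs ! i) s))"
          unfolding prod_set_iff by (rule exI[of _ "map (\<lambda>i. ds ! i) s"]) (simp add: s ds(3))
        ultimately show "(\<lambda>d\<in>prod_set (map (vdom D) xs). Tuple (map (\<lambda>i. entries d ! i) s)) d \<in> prod_set (map (vdom D) (map (\<lambda>i. xs ! i) s))"
          by simp
      qed simp
      ultimately show ?thesis using b(1-3)
        by (simp add: b(5) select_constr_def tuples_def)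
    qed
  qed
  moreover have "vdom (sat_pow k D) \<in> ?V \<rightarrow>\<^sub>E {A. finite A}"
    proof -
    have "finite (prod_set (map (vdom D) xs))" if "xs \<in> tuples k (vars D)" for xs
      using that dom by (intro finite_prod_set) (force simp: tuples_def)
    then show ?thesis by (auto simp: sat_pow_def)
  qed
  moreover have "vars (sat_pow k D) = ?V" "\<And>x. x \<in> ?V \<Longrightarrow> vdom (sat_pow k D) x = prod_set (map (vdom D) (entries x))"
    by (simp_all add: sat_pow_def)
  ultimately show ?thesis
    unfolding lc_instance_def by (simp add: finite_tuples fin)
qed

lemma act_closed:
  assumes "is_minion R" "finite D" "finite E" "\<alpha> \<in> D \<rightarrow>\<^sub>E E" "r \<in> obs R D"
  shows "act R D E \<alpha> r \<in> obs R E"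
proof -
  have "act R D E \<alpha> \<in> obs R D \<rightarrow> obs R E"
    using assms(1)[unfolded is_minion_def, THEN conjunct1, rule_format, OF assms(2-4)] .
  then show ?thesis using assms(5) by (rule funcset_mem)
qed

lemma act_id: "is_minion R \<Longrightarrow> finite D \<Longrightarrow> r \<in> obs R D \<Longrightarrow> act R D D (\<lambda>d\<in>D. d) r = r"
  by (simp add: is_minion_def)

lemma act_comp:
  assumes "is_minion R" "finite C" "finite D" "finite E" "\<alpha> \<in> D \<rightarrow>\<^sub>E E" "\<beta> \<in> C \<rightarrow>\<^sub>E D" "r \<in> obs R C"
  shows "act R D E \<alpha> (act R C D \<beta> r) = act R C E (compose C \<alpha> \<beta>) r"
  using assms(1)[unfolded is_minion_def, THEN conjunct2, THEN conjunct2, rule_format, OF assms(2-7)] .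

lemma ext_fin:
  assumes "lc_instance E" "ys \<in> tuples n (vars E)" "finite A"
  shows "finite (ext_set E ys A)"
proof -
  have "finite (vdom E y)" if "y \<in> vars E" for y using assms(1) that by (auto simp: lc_instance_def)
  with assms(2,3) have "\<forall>B\<in>set (A # map (vdom E) ys). finite B" by (auto simp: tuples_def subset_iff)
  then show ?thesis
    unfolding ext_set_def by (blast intro: finite_prod_set)
qed

lemma ext_map_PiE:
  assumes "\<alpha> \<in> A \<rightarrow>\<^sub>E B"
  shows "prod_map (A # map (vdom E) ys) (\<alpha> # map (\<lambda>y. \<lambda>d\<in>vdom E y. d) ys) \<in> ext_set E ys A \<rightarrow>\<^sub>E ext_set E ys B"
  unfolding ext_set_def
  using assms by (intro prod_map_PiE) (auto simp: nth_Cons split: nat.splits)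

lemma ext_act_closed:
  assumes "is_minion R" "lc_instance E" "ys \<in> tuples n (vars E)" "finite A" "finite B" "\<alpha> \<in> A \<rightarrow>\<^sub>E B" "w \<in> obs R (ext_set E ys A)"
  shows "ext_act R E ys A B \<alpha> w \<in> obs R (ext_set E ys B)"
proof -
  have "finite (ext_set E ys A)" "finite (ext_set E ys B)" using ext_fin[OF assms(2,3)] assms by auto
  then show ?thesis unfolding ext_act_def
    by (intro act_closed assms ext_map_PiE)
qed

lemma ext_act_id:
  assumes "is_minion R" "lc_instance E" "ys \<in> tuples n (vars E)" "finite A" "w \<in> obs R (ext_set E ys A)"
  shows "ext_act R E ys A A (\<lambda>d\<in>A. d) w = w"
proof -
  have "finite (ext_set E ys A)" by (rule ext_fin[OF assms(2-4)])
  moreover have "prod_map (A # map (vdom E) ys) ((\<lambda>d\<in>A. d) # map (\<lambda>y. \<lambda>d\<in>vdom E y. d) ys) = (\<lambda>d\<in>ext_set E ys A. d)"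
    unfolding ext_set_def by (rule prod_map_id) (auto simp: nth_Cons split: nat.splits)
  ultimately show ?thesis unfolding ext_act_def by (simp only: act_id[OF assms(1) _ assms(5)])
qed

lemma ext_act_comp:
  assumes "is_minion R" "lc_instance E" "ys \<in> tuples n (vars E)" "finite A" "finite B" "finite C" "\<beta> \<in> A \<rightarrow>\<^sub>E B" "\<alpha> \<in> B \<rightarrow>\<^sub>E C"
   "w \<in> obs R (ext_set E ys A)"
  shows "ext_act R E ys B C \<alpha> (ext_act R E ys A B \<beta> w) = ext_act R E ys A C (compose A \<alpha> \<beta>) w"
proof -
  have f: "finite (ext_set E ys A)" "finite (ext_set E ys B)"  "finite (ext_set E ys C)" using ext_fin[OF assms(2,3)] assms by auto
  let ?m = "\<lambda>A \<alpha>. prod_map (A # map (vdom E) ys) (\<alpha> # map (\<lambda>y. \<lambda>d\<in>vdom E y. d) ys)"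
  have "compose (ext_set E ys A) (?m B \<alpha>) (?m A \<beta>) = ?m A (compose A \<alpha> \<beta>)"
    unfolding ext_set_def using assms(7,8) by (intro prod_map_compose) (auto simp: nth_Cons compose_def split: nat.splits)
  moreover have "act R (ext_set E ys B) (ext_set E ys C) (?m B \<alpha>) (act R (ext_set E ys A) (ext_set E ys B) (?m A \<beta>) w) 
     = act R (ext_set E ys A) (ext_set E ys C) (compose (ext_set E ys A) (?m B \<alpha>) (?m A \<beta>)) w"
    by (intro act_comp assms f ext_map_PiE)
  ultimately show ?thesis unfolding ext_act_def by metis
qed

lemma sol_mem:
  assumes "solution R (sat_pow k E) r" "k \<ge> 1" "ys \<in> tuples (k - 1) (vars E)" "z \<in> vars E"
  shows "r (Tuple (z # ys)) \<in> obs R (ext_set E ys (vdom E z))"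
proof -
  have "z # ys \<in> tuples k (vars E)" using assms by (auto simp: tuples_def)
  then have m: "Tuple (z # ys) \<in> Tuple ` tuples k (vars E)" by blast
  have "r \<in> (\<Pi>\<^sub>E x\<in>Tuple ` tuples k (vars E). obs R (vdom (sat_pow k E) x))"
    using assms(1) by (simp add: solution_def sat_pow_def)
  from PiE_mem[OF this m] m show ?thesis
    by (simp add: sat_pow_def ext_set_def)
qed

lemma is_minion_lvl:
  assumes "is_minion R" "k \<ge> 1"
  shows "is_minion (lvl k R)"
proof -
  have 1: "act (lvl k R) A B \<alpha> t \<in> obs (lvl k R) B" 
    if "finite A" "finite B" and \<alpha>: "\<alpha> \<in> A \<rightarrow>\<^sub>E B" "t \<in> obs (lvl k R) A" for A B \<alpha> t
  proof -
    obtain E r w where t: "t = (E, r, w)" by (cases t)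
    with that obtain z \<beta> where E: "lc_instance E" "discrete E" and r: "solution R (sat_pow k E) r"
      and w: "w \<in> (\<Pi>\<^sub>E ys\<in>tuples (k - 1) (vars E). obs R (ext_set E ys A))"
      and z: "z \<in> vars E" "\<beta> \<in> vdom E z \<rightarrow>\<^sub>E A" "\<And>ys. ys \<in> tuples (k - 1) (vars E) \<Longrightarrow>
           w ys = ext_act R E ys (vdom E z) A \<beta> (r (Tuple (z # ys)))"
      by (auto simp: lvl_def)
    have "finite (vdom E z)" using E z by (auto simp: lc_instance_def)
    then have "ext_act R E ys A B \<alpha> (w ys) = ext_act R E ys (vdom E z) B (compose (vdom E z) \<alpha> \<beta>) (r (Tuple (z # ys)))"
      if "ys \<in> tuples (k - 1) (vars E)" for ys
      using that z(3)[OF that] ext_act_comp[OF assms(1) E(1) that _ \<open>finite A\<close> \<open>finite B\<close> z(2) \<alpha>(1) sol_mem[OF r assms(2) that z(1)]]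
      by simp
    moreover have "compose (vdom E z) \<alpha> \<beta> \<in> vdom E z \<rightarrow>\<^sub>E B" using z(2) \<alpha> by (auto simp: compose_def)
    moreover have "(\<lambda>ys\<in>tuples (k - 1) (vars E). ext_act R E ys A B \<alpha> (w ys)) \<in> (\<Pi>\<^sub>E ys\<in>tuples (k - 1) (vars E). obs R (ext_set E ys B))"
      using ext_act_closed[OF assms(1) E(1) _ that(1-3)] w by fastforce
    ultimately show ?thesis using E r z(1) by (simp add: lvl_def t) blast
  qed
  have 2: "act (lvl k R) A A (\<lambda>d\<in>A. d) t = t" if "finite A" "t \<in> obs (lvl k R) A" for A t
  proof -
    obtain E r w where t: "t = (E, r, w)" by (cases t)
    with that have E: "lc_instance E" 
      and w: "w \<in> (\<Pi>\<^sub>E ys\<in>tuples (k - 1) (vars E). obs R (ext_set E ys A))"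
      by (auto simp: lvl_def)
    have "(\<lambda>ys\<in>tuples (k - 1) (vars E). ext_act R E ys A A (\<lambda>d\<in>A. d) (w ys)) = w" 
    proof
      fix ys show "(\<lambda>ys\<in>tuples (k - 1) (vars E). ext_act R E ys A A (\<lambda>d\<in>A. d) (w ys)) ys = w ys"
        using ext_act_id[OF assms(1) E _ \<open>finite A\<close>, of ys "k - 1" "w ys"] w 
        by (cases "ys \<in> tuples (k - 1) (vars E)") (auto simp: PiE_mem)
    qed
    then show ?thesis by (simp add: lvl_def t)
  qed
  have 3: "act (lvl k R) B C \<alpha> (act (lvl k R) A B \<beta> t) = act (lvl k R) A C (compose A \<alpha> \<beta>) t" 
    if "finite A" "finite B" "finite C" "\<alpha> \<in> B \<rightarrow>\<^sub>E C" "\<beta> \<in> A \<rightarrow>\<^sub>E B" "t \<in> obs (lvl k R) A" for A B C \<alpha> \<beta> t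
  proof -
    obtain E r w where t: "t = (E, r, w)" by (cases t)
    with that have E: "lc_instance E" 
      and w: "w \<in> (\<Pi>\<^sub>E ys\<in>tuples (k - 1) (vars E). obs R (ext_set E ys A))"
      by (auto simp: lvl_def)
    have "ext_act R E ys B C \<alpha> (ext_act R E ys A B \<beta> (w ys)) = ext_act R E ys A C (compose A \<alpha> \<beta>) (w ys)"
      if "ys \<in> tuples (k - 1) (vars E)" for ys
      using ext_act_comp[OF assms(1) E that \<open>finite A\<close> \<open>finite B\<close> \<open>finite C\<close> \<open>\<beta> \<in> _\<close> \<open>\<alpha> \<in> _\<close> PiE_mem[OF w that]] .
    then show ?thesis
      by (simp add: lvl_def t cong: restrict_cong)
  qed
  show ?thesis unfolding is_minion_def
    by (intro conjI allI impI ballI funcsetI) (use 1 2 3 in \<open>assumption | simp\<close>)+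
qed

end

theory Submission
  imports Defs
begin

text \<open>
  A solution \<open>r\<close> of the power of \<open>D\<close> yields the triples \<open>(E, r, \<omega>\<^sub>x)\<close>, where \<open>E\<close> is \<open>D\<close> without its
  constraints and \<open>\<omega>\<^sub>x\<close> consists of the values of \<open>r\<close> at the tuples starting with \<open>x\<close>. Conversely, by
  connectedness all values of a solution in the level share the same \<open>E\<close> and \<open>r\<close>; if \<open>z\<^sub>x\<close> and \<open>\<beta>\<^sub>x\<close>
  witness \<open>\<omega>\<^sub>x\<close>, then the images of \<open>r\<close> at \<open>z\<^sub>x\<^sub>1\<dots>z\<^sub>x\<^sub>k\<close> under \<open>\<beta>\<^sub>x\<^sub>1 \<times> \<dots> \<times> \<beta>\<^sub>x\<^sub>k\<close> solve the power of \<open>D\<close>.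
  Indeed, a constraint \<open>x = \<alpha>(y)\<close> says that \<open>(\<alpha> \<circ> \<beta>\<^sub>y, z\<^sub>y)\<close> can be replaced by \<open>(\<beta>\<^sub>x, z\<^sub>x)\<close> in the
  first coordinate, and by the symmetry of \<open>r\<close> the coordinates can be treated one after another.
\<close>

section \<open>Coordinate selection, solutions of saturated powers, connected digraphs\<close>

text \<open>The map of \<open>select_constr\<close> for arbitrary factors, since it is needed for
  the codomains of pieces as well as for domains of variables.\<close>

definition select_map :: "'a obj set list \<Rightarrow> nat list \<Rightarrow> 'a obj \<Rightarrow> 'a obj" where
  "select_map As s = (\<lambda>d\<in>prod_set As. Tuple (map (\<lambda>i. entries d ! i) s))"

lemma select_map_PiE:
  assumes "set s \<subseteq> {0..<length As}"
  shows "select_map As s \<in> prod_set As \<rightarrow>\<^sub>E prod_set (map (\<lambda>i. As ! i) s)"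
proof
  fix d assume d: "d \<in> prod_set As"
  then obtain xs where xs: "d = Tuple xs" "length xs = length As" "\<And>i. i < length As \<Longrightarrow> xs ! i \<in> As ! i"
    by (auto simp: prod_set_iff)
  have "s ! j < length As" if "j < length s" for j
    using nth_mem[OF that] assms by auto
  then have "Tuple (map (\<lambda>i. xs ! i) s) \<in> prod_set (map (\<lambda>i. As ! i) s)"
    unfolding prod_set_iff by (intro exI[of _ "map (\<lambda>i. xs ! i) s"]) (simp add: xs)
  then show "select_map As s d \<in> prod_set (map (\<lambda>i. As ! i) s)"
    using d by (simp add: select_map_def xs(1))
qed (simp add: select_map_def)

text \<open>Naturality of selection in the factors. It carries the symmetry of \<open>r\<close> over
  to glued values in \<open>glue_select\<close>.\<close>

lemma select_map_prod_map:
  assumes "length fs = length As" "length Bs = length As"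
    "\<And>i. i < length As \<Longrightarrow> fs ! i \<in> As ! i \<rightarrow>\<^sub>E Bs ! i" "set s \<subseteq> {0..<length As}"
  shows "compose (prod_set As) (select_map Bs s) (prod_map As fs) =
    compose (prod_set As) (prod_map (map (\<lambda>i. As ! i) s) (map (\<lambda>i. fs ! i) s)) (select_map As s)"
    (is "?l = ?r")
proof
  fix d show "?l d = ?r d"
  proof (cases "d \<in> prod_set As")
    case True
    then obtain xs where xs: "d = Tuple xs" "length xs = length As"
      by (auto simp: prod_set_iff)
    have "prod_map As fs d \<in> prod_set Bs"
      using prod_map_PiE[OF assms(1-3)] True by (rule PiE_mem)
    moreover have "select_map As s d \<in> prod_set (map (\<lambda>i. As ! i) s)"
      using select_map_PiE[OF assms(4)] True by (rule PiE_mem)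
    moreover have "s ! j < length As" if "j < length s" for j
      using nth_mem[OF that] assms(4) by auto
    ultimately show ?thesis
      using True assms(1) xs
      by (auto simp: compose_def prod_map_def select_map_def intro!: nth_equalityI)
  qed (simp add: compose_def)
qed

lemma select_tuples:
  "xs \<in> tuples k X \<Longrightarrow> length s = n \<Longrightarrow> set s \<subseteq> {0..<k} \<Longrightarrow> map (\<lambda>i. xs ! i) s \<in> tuples n X"
  by (auto simp: tuples_def subset_iff)

text \<open>Replaces the constraint list and the restricted function
  \<open>vdom (sat_pow k D)\<close> once and for all by quantifiers and explicit products,
  separating product constraints from selection constraints.\<close>

lemma solution_sat_pow_iff:
  assumes "lc_instance D"
  shows "solution R (sat_pow k D) r \<longleftrightarrow>
    r \<in> (\<Pi>\<^sub>E x\<in>Tuple ` tuples k (vars D). obs R (prod_set (map (vdom D) (entries x)))) \<and>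
    (\<forall>cs. length cs = k \<longrightarrow> set cs \<subseteq> set (constrs D @ id_constrs D) \<longrightarrow>
      r (Tuple (map lhs cs)) =
        act R (prod_set (map (\<lambda>c. vdom D (rhs c)) cs)) (prod_set (map (\<lambda>c. vdom D (lhs c)) cs))
          (prod_map (map (\<lambda>c. vdom D (rhs c)) cs) (map fn cs)) (r (Tuple (map rhs cs)))) \<and>
    (\<forall>xs\<in>tuples k (vars D). \<forall>s. length s = k \<longrightarrow> set s \<subseteq> {0..<k} \<longrightarrow>
      r (Tuple (map (\<lambda>i. xs ! i) s)) =
        act R (prod_set (map (vdom D) xs)) (prod_set (map (vdom D) (map (\<lambda>i. xs ! i) s)))
          (select_map (map (vdom D) xs) s) (r (Tuple xs)))"
    (is "_ \<longleftrightarrow> ?mem \<and> (\<forall>cs. length cs = k \<longrightarrow> set cs \<subseteq> ?C \<longrightarrow> ?prod cs) \<and>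
      (\<forall>xs\<in>_. \<forall>s. length s = k \<longrightarrow> set s \<subseteq> _ \<longrightarrow> ?select xs s)")
proof -
  have fin: "finite (vars D)" using assms by (simp add: lc_instance_def)
  define ok where "ok c \<longleftrightarrow> r (lhs c) =
    act R (vdom (sat_pow k D) (rhs c)) (vdom (sat_pow k D) (lhs c)) (fn c) (r (rhs c))" for c
  have C: "lhs c \<in> vars D \<and> rhs c \<in> vars D" if "c \<in> ?C" for c
    using that assms by (auto simp: lc_instance_def id_constrs_def set_enum fin)
  have dom: "vdom (sat_pow k D) (Tuple xs) = prod_set (map (vdom D) xs)"
    if "xs \<in> tuples k (vars D)" for xs
    using that by (simp add: sat_pow_def)
  have prod: "ok (prod_constr D cs) \<longleftrightarrow> ?prod cs" if "length cs = k" "set cs \<subseteq> ?C" for cs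
  proof -
    have "map lhs cs \<in> tuples k (vars D)" "map rhs cs \<in> tuples k (vars D)"
      using that C by (auto simp: tuples_def)
    then show ?thesis by (simp add: ok_def prod_constr_def dom o_def)
  qed
  have select: "ok (select_constr D xs s) \<longleftrightarrow> ?select xs s"
    if "xs \<in> tuples k (vars D)" "length s = k" "set s \<subseteq> {0..<k}" for xs s
    using dom[OF that(1)] dom[OF select_tuples[OF that]]
    by (simp add: ok_def select_constr_def select_map_def)
  have vars: "vars (sat_pow k D) = Tuple ` tuples k (vars D)" by (simp add: sat_pow_def)
  have "(\<Pi>\<^sub>E x\<in>Tuple ` tuples k (vars D). obs R (vdom (sat_pow k D) x)) =
      (\<Pi>\<^sub>E x\<in>Tuple ` tuples k (vars D). obs R (prod_set (map (vdom D) (entries x))))"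
    by (rule PiE_cong) (auto simp: dom)
  note mem = arg_cong[OF this, of "\<lambda>F. r \<in> F"]
  have "(\<forall>c\<in>set (constrs (sat_pow k D)). ok c) \<longleftrightarrow>
    (\<forall>cs. length cs = k \<longrightarrow> set cs \<subseteq> ?C \<longrightarrow> ok (prod_constr D cs)) \<and>
    (\<forall>xs\<in>tuples k (vars D). \<forall>s. length s = k \<longrightarrow> set s \<subseteq> {0..<k} \<longrightarrow> ok (select_constr D xs s))"
    unfolding set_constrs_sat_pow[OF fin] tuples_def by blast
  then show ?thesis
    unfolding solution_def vars mem ok_def[symmetric] using prod select by blast
qed

text \<open>An undirected path is a directed path in the symmetric closure, and \<open>f\<close> is
  preserved by an arc in either direction.\<close>

lemma connected_constant:
  assumes "connected G" "u \<in> verts G" "v \<in> verts G"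
    and arc: "\<And>e. e \<in> arcs G \<Longrightarrow> f (tail G e) = f (head G e)"
  shows "f u = f v"
proof -
  have "u \<rightarrow>\<^sup>*\<^bsub>mk_symmetric G\<^esub> v"
    using assms(1-3) by (auto simp: connected_def strongly_connected_def mk_symmetric_def)
  then show ?thesis
    unfolding reachable_def
    by (induction rule: rtrancl_on_induct) (auto simp: parcs_mk_symmetric dest: arc)
qed

section \<open>Gluing pieces along a solution of a power\<close>

text \<open>
  A \<open>piece\<close> \<open>(A, \<gamma>, z)\<close> is a map \<open>\<gamma> : E\<^sub>z \<rightarrow> A\<close>. Gluing \<open>(A\<^sub>i, \<gamma>\<^sub>i, z\<^sub>i)\<close>, \<open>i = 1, \<dots>, k\<close>, gives
  the image of \<open>r\<close> at \<open>z\<^sub>1\<dots>z\<^sub>k\<close> under \<open>R\<close> of \<open>\<gamma>\<^sub>1 \<times> \<dots> \<times> \<gamma>\<^sub>k\<close>.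
\<close>

type_synonym 'a piece = "'a obj set \<times> ('a obj \<Rightarrow> 'a obj) \<times> 'a obj"

abbreviation cod :: "'a piece \<Rightarrow> 'a obj set" where "cod p \<equiv> fst p"
abbreviation map_of_piece :: "'a piece \<Rightarrow> 'a obj \<Rightarrow> 'a obj" where "map_of_piece p \<equiv> fst (snd p)"
abbreviation src :: "'a piece \<Rightarrow> 'a obj" where "src p \<equiv> snd (snd p)"

locale power_solution =
  fixes R :: "('a, 'r) minion" and E :: "'a lc" and k :: nat and r :: "'a obj \<Rightarrow> 'r"
  assumes minion: "is_minion R" and k: "k \<ge> 1" and inst: "lc_instance E"
    and sol: "solution R (sat_pow k E) r"
begin

definition piece :: "'a piece \<Rightarrow> bool" where
  "piece p \<longleftrightarrow> finite (cod p) \<and> src p \<in> vars E \<and> map_of_piece p \<in> vdom E (src p) \<rightarrow>\<^sub>E cod p"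

definition dom_set :: "'a piece list \<Rightarrow> 'a obj set" where
  "dom_set ps = prod_set (map (\<lambda>p. vdom E (src p)) ps)"

definition pieces_map :: "'a piece list \<Rightarrow> 'a obj \<Rightarrow> 'a obj" where
  "pieces_map ps = prod_map (map (\<lambda>p. vdom E (src p)) ps) (map map_of_piece ps)"

definition glue :: "'a piece list \<Rightarrow> 'r" where
  "glue ps = act R (dom_set ps) (prod_set (map cod ps)) (pieces_map ps) (r (Tuple (map src ps)))"

text \<open>The two sides are the entries at \<open>ys\<close> of the third component of the level
  elements witnessed by \<open>p\<close> and by \<open>q\<close>, with \<open>src\<close> as the
  variable and \<open>map_of_piece\<close> as the map.\<close>

definition piece_eq :: "'a piece \<Rightarrow> 'a piece \<Rightarrow> bool" where
  "piece_eq p q \<longleftrightarrow> cod p = cod q \<and> (\<forall>ys\<in>tuples (k - 1) (vars E).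
     ext_act R E ys (vdom E (src p)) (cod p) (map_of_piece p) (r (Tuple (src p # ys))) =
     ext_act R E ys (vdom E (src q)) (cod q) (map_of_piece q) (r (Tuple (src q # ys))))"

lemma finite_vdom: "z \<in> vars E \<Longrightarrow> finite (vdom E z)"
  using inst by (auto simp: lc_instance_def)

lemma finite_dom_set: "\<forall>p\<in>set ps. piece p \<Longrightarrow> finite (dom_set ps)"
  unfolding dom_set_def by (rule finite_prod_set) (auto simp: piece_def finite_vdom)

lemma finite_cod: "\<forall>p\<in>set ps. piece p \<Longrightarrow> finite (prod_set (map cod ps))"
  by (rule finite_prod_set) (auto simp: piece_def)

lemma pieces_map_PiE:
  assumes "\<forall>p\<in>set ps. piece p"
  shows "pieces_map ps \<in> dom_set ps \<rightarrow>\<^sub>E prod_set (map cod ps)"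
proof -
  have "piece (ps ! i)" if "i < length ps" for i using assms that by simp
  then show ?thesis
    unfolding dom_set_def pieces_map_def by (intro prod_map_PiE) (auto simp: piece_def)
qed

lemma src_tuples: "\<forall>p\<in>set ps. piece p \<Longrightarrow> map src ps \<in> tuples (length ps) (vars E)"
  by (auto simp: tuples_def piece_def)

lemma r_mem:
  assumes "\<forall>p\<in>set ps. piece p" "length ps = k"
  shows "r (Tuple (map src ps)) \<in> obs R (dom_set ps)"
proof -
  have "r \<in> (\<Pi>\<^sub>E x\<in>Tuple ` tuples k (vars E). obs R (prod_set (map (vdom E) (entries x))))"
    using sol by (simp add: solution_sat_pow_iff[OF inst])
  from PiE_mem[OF this, of "Tuple (map src ps)"] src_tuples[OF assms(1)] assms(2) show ?thesis
    by (simp add: dom_set_def o_def)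
qed

lemma r_select:
  assumes "\<forall>p\<in>set ps. piece p" "length ps = k" "length s = k" "set s \<subseteq> {0..<k}"
  shows "r (Tuple (map src (map (\<lambda>i. ps ! i) s))) =
    act R (dom_set ps) (dom_set (map (\<lambda>i. ps ! i) s))
      (select_map (map (\<lambda>p. vdom E (src p)) ps) s) (r (Tuple (map src ps)))"
proof -
  have t: "map src ps \<in> tuples k (vars E)" using src_tuples[OF assms(1)] assms(2) by simp
  have i: "i < length ps" if "i \<in> set s" for i using that assms by auto
  have m: "map (\<lambda>i. map src ps ! i) s = map src (map (\<lambda>i. ps ! i) s)"
    by (simp add: i)
  have "r (Tuple (map (\<lambda>i. map src ps ! i) s)) =
      act R (prod_set (map (vdom E) (map src ps))) (prod_set (map (vdom E) (map (\<lambda>i. map src ps ! i) s)))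
        (select_map (map (vdom E) (map src ps)) s) (r (Tuple (map src ps)))"
    using sol t assms(3,4) unfolding solution_sat_pow_iff[OF inst] by blast
  then show ?thesis unfolding m dom_set_def by (simp add: o_def)
qed

lemma glue_mem:
  assumes "\<forall>p\<in>set ps. piece p" "length ps = k"
  shows "glue ps \<in> obs R (prod_set (map cod ps))"
  unfolding glue_def
  by (intro act_closed minion finite_dom_set finite_cod pieces_map_PiE r_mem assms)

text \<open>Functoriality of \<open>R\<close>: the product of the \<alpha>'s composed with the
  product of the maps of \<open>ps\<close> is the product of the maps of \<open>qs\<close>.\<close>

lemma glue_push:
  assumes ps: "\<forall>p\<in>set ps. piece p" "length ps = k" and qs: "\<forall>q\<in>set qs. piece q" "length qs = k"
    and \<alpha>s: "length \<alpha>s = k"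
    and src: "\<And>i. i < k \<Longrightarrow> src (qs ! i) = src (ps ! i)"
    and \<alpha>: "\<And>i. i < k \<Longrightarrow> \<alpha>s ! i \<in> cod (ps ! i) \<rightarrow>\<^sub>E cod (qs ! i)"
    and comp: "\<And>i x. i < k \<Longrightarrow> x \<in> vdom E (src (ps ! i)) \<Longrightarrow>
      map_of_piece (qs ! i) x = (\<alpha>s ! i) (map_of_piece (ps ! i) x)"
  shows "act R (prod_set (map cod ps)) (prod_set (map cod qs)) (prod_map (map cod ps) \<alpha>s) (glue ps) = glue qs"
proof -
  have eq: "map src qs = map src ps" "map (\<lambda>p. vdom E (src p)) qs = map (\<lambda>p. vdom E (src p)) ps"
    using src ps qs by (auto intro!: nth_equalityI)
  have p: "piece (ps ! i)" if "i < k" for i using ps that by simp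
  have \<alpha>P: "prod_map (map cod ps) \<alpha>s \<in> prod_set (map cod ps) \<rightarrow>\<^sub>E prod_set (map cod qs)"
    using \<alpha> ps qs \<alpha>s by (intro prod_map_PiE) auto
  have "compose (dom_set ps) (prod_map (map cod ps) \<alpha>s) (pieces_map ps) = pieces_map qs"
    unfolding dom_set_def pieces_map_def eq
    using ps qs \<alpha>s comp p by (intro prod_map_compose) (auto simp: piece_def)
  moreover have "dom_set qs = dom_set ps" by (simp add: dom_set_def eq)
  ultimately show ?thesis unfolding glue_def eq(1)
    by (subst act_comp[OF minion]) (simp_all add: finite_dom_set finite_cod pieces_map_PiE r_mem \<alpha>P ps qs)
qed

text \<open>The selection constraint satisfied by \<open>r\<close> rearranges the sources, and
  naturality moves the selection past the product of the maps.\<close>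

lemma glue_select:
  assumes ps: "\<forall>p\<in>set ps. piece p" "length ps = k" and s: "length s = k" "set s \<subseteq> {0..<k}"
  shows "glue (map (\<lambda>i. ps ! i) s) =
    act R (prod_set (map cod ps)) (prod_set (map cod (map (\<lambda>i. ps ! i) s)))
      (select_map (map cod ps) s) (glue ps)"
proof -
  let ?qs = "map (\<lambda>i. ps ! i) s"
  have i: "i < length ps" if "i \<in> set s" for i using that ps s by auto
  have qs: "\<forall>q\<in>set ?qs. piece q" using i ps by auto
  have p: "piece (ps ! i)" if "i < k" for i using ps that by simp
  have m: "map f ?qs = map (\<lambda>i. map f ps ! i) s" for f :: "'a piece \<Rightarrow> 'b"
    by (simp add: i)
  have sel1: "select_map (map (\<lambda>p. vdom E (src p)) ps) s \<in> dom_set ps \<rightarrow>\<^sub>E dom_set ?qs"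
    unfolding dom_set_def m using ps s by (intro select_map_PiE) auto
  have sel2: "select_map (map cod ps) s \<in> prod_set (map cod ps) \<rightarrow>\<^sub>E prod_set (map cod ?qs)"
    unfolding m using ps s by (intro select_map_PiE) auto
  have "compose (dom_set ps) (select_map (map cod ps) s) (pieces_map ps) =
      compose (dom_set ps) (pieces_map ?qs) (select_map (map (\<lambda>p. vdom E (src p)) ps) s)"
    unfolding dom_set_def pieces_map_def m
    using ps s p by (intro select_map_prod_map) (auto simp: piece_def)
  then show ?thesis
    unfolding glue_def r_select[OF ps s]
    using finite_dom_set[OF ps(1)] finite_dom_set[OF qs] finite_cod[OF ps(1)] finite_cod[OF qs]
      pieces_map_PiE[OF ps(1)] pieces_map_PiE[OF qs] r_mem[OF ps] sel1 sel2
    by (simp add: act_comp[OF minion] del: map_map)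
qed

text \<open>
  \<open>\<gamma>\<^sub>1 \<times> \<dots> \<times> \<gamma>\<^sub>k\<close> factors through \<open>\<gamma>\<^sub>1 \<times> id \<times> \<dots> \<times> id\<close>, which is all that \<open>piece_eq\<close> sees.
\<close>

lemma glue_head:
  assumes pq: "piece p" "piece q" "piece_eq p q"
    and ps: "\<forall>p\<in>set ps. piece p" "length (p # ps) = k"
  shows "glue (p # ps) = glue (q # ps)"
proof -
  define ys where "ys = map src ps"
  have ys: "ys \<in> tuples (k - 1) (vars E)"
    using src_tuples[OF ps(1)] ps(2) by (auto simp: ys_def)
  \<comment> \<open>The second factor, which leaves the first coordinate alone and applies the
    remaining maps. It depends on the first piece only through its codomain, so it is the same for
    \<open>p\<close> and \<open>q\<close>.\<close>
  define m where "m A = prod_map (A # map (vdom E) ys) ((\<lambda>d\<in>A. d) # map map_of_piece ps)" for A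
  have psi: "piece (ps ! i)" if "i < length ps" for i using ps that by simp
  have *: "glue (p # ps) = act R (ext_set E ys (cod p)) (prod_set (map cod (p # ps))) (m (cod p))
      (ext_act R E ys (vdom E (src p)) (cod p) (map_of_piece p) (r (Tuple (src p # ys))))"
    if p: "piece p" for p
  proof -
    have all: "\<forall>p\<in>set (p # ps). piece p" "length (p # ps) = k" using p ps by auto
    let ?e = "prod_map (vdom E (src p) # map (vdom E) ys)
      (map_of_piece p # map (\<lambda>y. \<lambda>d\<in>vdom E y. d) ys)"
    have d: "dom_set (p # ps) = ext_set E ys (vdom E (src p))"
      by (simp add: dom_set_def ext_set_def ys_def o_def)
    have e: "?e \<in> dom_set (p # ps) \<rightarrow>\<^sub>E ext_set E ys (cod p)"
      unfolding d using p by (intro ext_map_PiE) (simp add: piece_def)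
    have mP: "m (cod p) \<in> ext_set E ys (cod p) \<rightarrow>\<^sub>E prod_set (map cod (p # ps))"
      unfolding m_def ext_set_def
      using psi by (intro prod_map_PiE) (auto simp: ys_def nth_Cons piece_def split: nat.splits)
    have "compose (dom_set (p # ps)) (m (cod p)) ?e = pieces_map (p # ps)"
      unfolding d m_def ext_set_def pieces_map_def
      using p psi
      by (simp add: ys_def o_def, intro prod_map_compose)
        (auto simp: nth_Cons piece_def split: nat.splits)
    moreover have "finite (ext_set E ys (cod p))"
      using p by (intro ext_fin[OF inst ys]) (simp add: piece_def)
    ultimately show ?thesis
      using act_comp[OF minion finite_dom_set[OF all(1)] _ finite_cod[OF all(1)] mP e r_mem[OF all]]
      by (simp add: glue_def ext_act_def d ys_def)
  qed
  have "cod p = cod q" using pq(3) by (simp add: piece_eq_def)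
  moreover have "ext_act R E ys (vdom E (src p)) (cod p) (map_of_piece p) (r (Tuple (src p # ys))) =
      ext_act R E ys (vdom E (src q)) (cod q) (map_of_piece q) (r (Tuple (src q # ys)))"
    using pq(3) ys unfolding piece_eq_def by blast
  ultimately show ?thesis unfolding *[OF pq(1)] *[OF pq(2)] by (simp only: list.map)
qed

text \<open>Moving the last coordinate to the front is a selection, and its map depends only on the
  codomains, which agree on both sides.\<close>

lemma glue_rotate:
  assumes ps: "\<forall>x\<in>set ps. piece x" "\<forall>x\<in>set qs. piece x" "piece p" "length ps + 1 = k"
    and qs: "map cod qs = map cod ps" and eq: "glue (ps @ [p]) = glue (qs @ [p])"
  shows "glue (p # ps) = glue (p # qs)"
proof -
  \<comment> \<open>Indices count from 0, so \<open>length ps\<close> is the last coordinate, the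
    position of \<open>p\<close>.\<close>
  let ?s = "length ps # [0..<length ps]"
  have len: "length qs = length ps" using arg_cong[OF qs, of length] by simp
  have "map (\<lambda>i. (xs @ [p]) ! i) (length xs # [0..<length xs]) = p # xs" for xs :: "'a piece list"
    by (auto simp: nth_append intro!: nth_equalityI)
  note sel = this[of ps] this[of qs, unfolded len]
  have s: "length ?s = k" "set ?s \<subseteq> {0..<k}" using ps(4) by auto
  have "glue (p # ps) = act R (prod_set (map cod (ps @ [p]))) (prod_set (map cod (p # ps)))
      (select_map (map cod (ps @ [p])) ?s) (glue (ps @ [p]))"
    using glue_select[of "ps @ [p]" ?s] s ps unfolding sel by auto
  moreover have "glue (p # qs) = act R (prod_set (map cod (qs @ [p]))) (prod_set (map cod (p # qs)))
      (select_map (map cod (qs @ [p])) ?s) (glue (qs @ [p]))"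
    using glue_select[of "qs @ [p]" ?s] s ps len unfolding sel by auto
  ultimately show ?thesis using eq qs by simp
qed

text \<open>Only the first coordinate can be exchanged directly, so each exchanged piece is rotated
  to the end to expose the next one.\<close>

lemma glue_cong:
  assumes "list_all2 (\<lambda>p q. piece p \<and> piece q \<and> piece_eq p q) ps qs" "length ps = k"
  shows "glue ps = glue qs"
proof -
  \<comment> \<open>The arbitrary tail \<open>us\<close> collects the coordinates already treated
    and keeps the total length equal to \<open>k\<close> during the induction.\<close>
  have "glue (ps @ us) = glue (qs @ us)"
    if "list_all2 (\<lambda>p q. piece p \<and> piece q \<and> piece_eq p q) ps qs"
      "\<forall>u\<in>set us. piece u" "length ps + length us = k" for us
    using that
  proof (induction arbitrary: us rule: list_all2_induct)
    case (Cons p ps q qs)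
    from Cons.hyps(2) have "(\<forall>x\<in>set ps. piece x) \<and> (\<forall>x\<in>set qs. piece x) \<and>
      map cod ps = map cod qs \<and> length ps = length qs"
      by (induction rule: list_all2_induct) (auto simp: piece_eq_def)
    then have P: "\<forall>x\<in>set ps. piece x" "\<forall>x\<in>set qs. piece x"
      "map cod ps = map cod qs" "length ps = length qs"
      by blast+
    have "glue (p # ps @ us) = glue (q # ps @ us)"
      using Cons P by (intro glue_head) auto
    \<comment> \<open>The induction hypothesis for the tail \<open>us @ [q]\<close> has
      \<open>q\<close> in last position; rotation brings it back to the front.\<close>
    also have "\<dots> = glue (q # qs @ us)"
      using Cons P Cons.IH[of "us @ [q]"] by (intro glue_rotate) auto
    finally show ?case by simp
  qed simp
  from this[of "[]"] assms show ?thesis by simp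
qed

end

section \<open>From the power to the level\<close>

lemma solution_lvl_if_solution_sat_pow:
  assumes R: "is_minion R" and k: "k \<ge> 1" and D: "lc_instance D" and r: "solution R (sat_pow k D) r"
  shows "\<exists>s. solution (lvl k R) D s"
proof -
  define E where "E = D\<lparr>constrs := []\<rparr>"
  have E: "vars E = vars D" "vdom E = vdom D" "discrete E" "lc_instance E" "id_constrs E = id_constrs D" "constrs E = []"
    using D by (auto simp: E_def discrete_def lc_instance_def id_constrs_def)
  \<comment> \<open>The product constraints of the power of \<open>E\<close> use only identities, so
    they are among those of the power of \<open>D\<close>.\<close>
  have rE: "solution R (sat_pow k E) r"
    using r unfolding solution_sat_pow_iff[OF D] solution_sat_pow_iff[OF E(4)]
    by (simp add: E) blast
  have fin: "finite (vars D)" using D by (simp add: lc_instance_def)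
  define \<omega> where "\<omega> x = (\<lambda>ys\<in>tuples (k - 1) (vars D). r (Tuple (x # ys)))" for x
  define s where "s = (\<lambda>x\<in>vars D. (E, r, \<omega> x))"
  have "s \<in> (\<Pi>\<^sub>E x\<in>vars D. obs (lvl k R) (vdom D x))"
  proof -
    have "s x \<in> obs (lvl k R) (vdom D x)" if x: "x \<in> vars D" for x
    proof -
      have m: "r (Tuple (x # ys)) \<in> obs R (ext_set E ys (vdom E x))"
        if "ys \<in> tuples (k - 1) (vars E)" for ys
        using sol_mem[OF rE k that] x E by simp
      \<comment> \<open>The witnesses for membership in the level are the variable \<open>x\<close>
        itself and the identity map.\<close>
      have "\<omega> x ys = ext_act R E ys (vdom E x) (vdom D x) (\<lambda>d\<in>vdom E x. d) (r (Tuple (x # ys)))"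
        if ys: "ys \<in> tuples (k - 1) (vars E)" for ys
      proof -
        have "finite (vdom E x)" using x E(4) by (auto simp: lc_instance_def E(1))
        from ext_act_id[OF R E(4) ys this m[OF ys]] show ?thesis
          using ys by (simp add: \<omega>_def E)
      qed
      moreover have "\<omega> x \<in> (\<Pi>\<^sub>E ys\<in>tuples (k - 1) (vars E). obs R (ext_set E ys (vdom D x)))"
        using m by (auto simp: \<omega>_def E)
      moreover have "(\<lambda>d\<in>vdom E x. d) \<in> vdom E x \<rightarrow>\<^sub>E vdom D x" by (auto simp: E)
      moreover have "x \<in> vars E" using x by (simp add: E)
      ultimately show ?thesis
        using E(3,4) rE x unfolding lvl_def s_def
        by (simp del: One_nat_def) (intro bexI[of _ x] bexI[of _ "\<lambda>d\<in>vdom E x. d"] ballI; simp)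
    qed
    then show ?thesis by (simp add: s_def PiE_iff)
  qed
  moreover have "s (lhs c) = act (lvl k R) (vdom D (rhs c)) (vdom D (lhs c)) (fn c) (s (rhs c))"
    if c: "c \<in> set (constrs D)" for c
  proof -
    have lr: "lhs c \<in> vars D" "rhs c \<in> vars D" using c D by (auto simp: lc_instance_def)
    have "r (Tuple (lhs c # ys)) = ext_act R E ys (vdom D (rhs c)) (vdom D (lhs c)) (fn c) (r (Tuple (rhs c # ys)))"
      if ys: "ys \<in> tuples (k - 1) (vars D)" for ys
    proof -
      \<comment> \<open>With \<open>c\<close> in the first coordinate and identities elsewhere, the
        product constraint of the power is the action of \<open>fn c\<close> in the level.\<close>
      let ?cs = "c # map (\<lambda>x. Constr x (\<lambda>d\<in>vdom D x. d) x) ys"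
      have "length ?cs = k" using ys k by (simp add: tuples_def)
      moreover have "set ?cs \<subseteq> set (constrs D @ id_constrs D)"
        using ys c by (auto simp: tuples_def id_constrs_def set_enum fin)
      ultimately have "r (Tuple (map lhs ?cs)) =
        act R (prod_set (map (\<lambda>c. vdom D (rhs c)) ?cs)) (prod_set (map (\<lambda>c. vdom D (lhs c)) ?cs))
          (prod_map (map (\<lambda>c. vdom D (rhs c)) ?cs) (map fn ?cs)) (r (Tuple (map rhs ?cs)))"
        using r unfolding solution_sat_pow_iff[OF D] by blast
      then show ?thesis by (simp add: ext_act_def ext_set_def E o_def)
    qed
    then show ?thesis
      using lr by (auto simp: s_def lvl_def \<omega>_def E intro!: restrict_ext)
  qed
  ultimately have "solution (lvl k R) D s" unfolding solution_def by blast
  then show ?thesis by (rule exI[of _ s])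
qed

section \<open>From the level to the power\<close>

lemma solution_sat_pow_if_solution_lvl:
  assumes R: "is_minion R" and k: "k \<ge> 1" and D: "lc_instance D" and conn: "lc_connected D"
    and s: "solution (lvl k R) D s"
  shows "\<exists>t. solution R (sat_pow k D) t"
proof (cases "vars D = {}")
  \<comment> \<open>Since \<open>k \<ge> 1\<close>, there are no \<open>k\<close>-tuples, so the
    power has neither variables nor constraints. The case is separate because
    \<open>connected\<close> excludes the empty digraph.\<close>
  case True
  then have "tuples k (vars D) = {}" "constrs D = []" "id_constrs D = []"
    using k D set_enum[of "vars D"] by (auto simp: tuples_def lc_instance_def id_constrs_def)
  then have "solution R (sat_pow k D) (\<lambda>_. undefined)"
    using k unfolding solution_sat_pow_iff[OF D] by auto
  then show ?thesis by (rule exI[of _ "\<lambda>_. undefined"])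
next
  case False
  then obtain x0 where x0: "x0 \<in> vars D" by auto
  obtain E r \<omega>0 where Er: "s x0 = (E, r, \<omega>0)" by (cases "s x0")
  have fin: "finite (vars D)" using D by (simp add: lc_instance_def)
  have findom: "finite (vdom D x)" if "x \<in> vars D" for x using that D by (auto simp: lc_instance_def)
  have s_mem: "s x \<in> obs (lvl k R) (vdom D x)" if "x \<in> vars D" for x
    using s that by (auto simp: solution_def)
  have s_con: "s (lhs c) = act (lvl k R) (vdom D (rhs c)) (vdom D (lhs c)) (fn c) (s (rhs c))"
    if "c \<in> set (constrs D)" for c
    using s that by (auto simp: solution_def)
  have conn': "connected (shape D)" using conn False by (simp add: lc_connected_def)
  have const: "(fst (s x), fst (snd (s x))) = (E, r)" if "x \<in> vars D" for x
  proof -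
    have "(fst (s x), fst (snd (s x))) = (fst (s x0), fst (snd (s x0)))"
    \<comment> \<open>The action of the level changes only the third component of a triple.\<close>
    proof (rule connected_constant[OF conn', where f = "\<lambda>x. (fst (s x), fst (snd (s x)))"])
      fix e assume "e \<in> arcs (shape D)"
      then have e: "constrs D ! e \<in> set (constrs D)" by (simp add: shape_def)
      show "(fst (s (tail (shape D) e)), fst (snd (s (tail (shape D) e)))) =
        (fst (s (head (shape D) e)), fst (snd (s (head (shape D) e))))"
        using s_con[OF e] by (simp add: shape_def lvl_def split: prod.splits)
    qed (use that x0 in \<open>simp_all add: shape_def\<close>)
    then show ?thesis by (simp add: Er)
  qed
  define \<omega> where "\<omega> x = snd (snd (s x))" for x
  have sx: "s x = (E, r, \<omega> x)" if "x \<in> vars D" for x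
    using const[OF that] by (cases "s x") (simp add: \<omega>_def)
  have Ek: "lc_instance E" "solution R (sat_pow k E) r"
    using s_mem[OF x0] by (auto simp: sx[OF x0] lvl_def)
  interpret power_solution R E k r by unfold_locales (fact R k Ek)+
  have "\<forall>x\<in>vars D. \<exists>z\<in>vars E. \<exists>\<beta>\<in>vdom E z \<rightarrow>\<^sub>E vdom D x. \<forall>ys\<in>tuples (k - 1) (vars E).
      \<omega> x ys = ext_act R E ys (vdom E z) (vdom D x) \<beta> (r (Tuple (z # ys)))"
    using s_mem by (auto simp: sx lvl_def)
  then obtain z \<beta> where z: "\<And>x. x \<in> vars D \<Longrightarrow> z x \<in> vars E"
    and \<beta>: "\<And>x. x \<in> vars D \<Longrightarrow> \<beta> x \<in> vdom E (z x) \<rightarrow>\<^sub>E vdom D x"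
    and \<omega>: "\<And>x ys. x \<in> vars D \<Longrightarrow> ys \<in> tuples (k - 1) (vars E) \<Longrightarrow>
      \<omega> x ys = ext_act R E ys (vdom E (z x)) (vdom D x) (\<beta> x) (r (Tuple (z x # ys)))"
    by metis
  have \<omega>_mem: "\<omega> x ys \<in> obs R (ext_set E ys (vdom D x))"
    if "x \<in> vars D" "ys \<in> tuples (k - 1) (vars E)" for x ys
    using s_mem[OF that(1)] that by (auto simp: sx lvl_def)
  define P where "P x = (vdom D x, \<beta> x, z x)" for x
  have P: "piece (P x)" if "x \<in> vars D" for x
    using that z \<beta> by (simp add: P_def piece_def findom)
  define t where "t = (\<lambda>x\<in>Tuple ` tuples k (vars D). glue (map P (entries x)))"
  have tT: "t (Tuple xs) = glue (map P xs)" if "xs \<in> tuples k (vars D)" for xs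
    using that by (simp add: t_def)
  have Pxs: "\<forall>p\<in>set (map P xs). piece p" "length (map P xs) = k" if "xs \<in> tuples k (vars D)" for xs
    using that P by (auto simp: tuples_def)
  have codP: "map cod (map P xs) = map (vdom D) xs" for xs by (simp add: P_def o_def)
  have C: "lhs c \<in> vars D" "rhs c \<in> vars D" "fn c \<in> vdom D (rhs c) \<rightarrow>\<^sub>E vdom D (lhs c)"
    if "c \<in> set (constrs D @ id_constrs D)" for c
    using that D by (auto simp: lc_instance_def id_constrs_def set_enum fin)
  \<comment> \<open>Product constraints of the power mix constraints of \<open>D\<close> with
    identities, so the equation is needed for both kinds.\<close>
  have \<omega>_con: "\<omega> (lhs c) ys = ext_act R E ys (vdom D (rhs c)) (vdom D (lhs c)) (fn c) (\<omega> (rhs c) ys)"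
    if c: "c \<in> set (constrs D @ id_constrs D)" and ys: "ys \<in> tuples (k - 1) (vars E)" for c ys
  proof (cases "c \<in> set (constrs D)")
    case True
    with s_con[OF True] sx C[OF c] ys show ?thesis by (simp add: lvl_def)
  next
    case False
    then obtain x where x: "x \<in> vars D" "c = Constr x (\<lambda>d\<in>vdom D x. d) x"
      using c by (auto simp: id_constrs_def set_enum fin)
    show ?thesis
      using ext_act_id[OF R Ek(1) ys findom[OF x(1)] \<omega>_mem[OF x(1) ys]] by (simp add: x(2))
  qed
  \<comment> \<open>\<open>Q c\<close> is the piece \<open>P (rhs c)\<close> followed by
    \<open>fn c\<close>; its source is still that of \<open>rhs c\<close>.\<close>
  define Q where "Q c = (vdom D (lhs c), compose (vdom E (z (rhs c))) (fn c) (\<beta> (rhs c)), z (rhs c))" for c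
  have Q: "piece (Q c)" if c: "c \<in> set (constrs D @ id_constrs D)" for c
    using C[OF c] z[OF C(2)[OF c]] \<beta>[OF C(2)[OF c]] by (auto simp: Q_def piece_def findom compose_def)
  \<comment> \<open>Both pieces produce \<open>\<omega> (lhs c)\<close>: \<open>Q c\<close> by the
    constraint \<open>c\<close>, and \<open>P (lhs c)\<close> by the choice of its
    witnesses.\<close>
  have QP: "piece_eq (Q c) (P (lhs c))" if c: "c \<in> set (constrs D @ id_constrs D)" for c
    unfolding piece_eq_def
  proof (intro conjI ballI)
    fix ys assume ys: "ys \<in> tuples (k - 1) (vars E)"
    note z' = z[OF C(2)[OF c]]
    have "ext_act R E ys (vdom E (z (rhs c))) (vdom D (lhs c))
        (compose (vdom E (z (rhs c))) (fn c) (\<beta> (rhs c))) (r (Tuple (z (rhs c) # ys))) = \<omega> (lhs c) ys"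
      using ext_act_comp[OF R Ek(1) ys finite_vdom[OF z'] findom[OF C(2)[OF c]] findom[OF C(1)[OF c]]
          \<beta>[OF C(2)[OF c]] C(3)[OF c] sol_mem[OF Ek(2) k ys z']]
      by (simp add: \<omega>_con[OF c ys] \<omega>[OF C(2)[OF c] ys])
    then show "ext_act R E ys (vdom E (src (Q c))) (cod (Q c)) (map_of_piece (Q c)) (r (Tuple (src (Q c) # ys))) =
      ext_act R E ys (vdom E (src (P (lhs c)))) (cod (P (lhs c))) (map_of_piece (P (lhs c)))
        (r (Tuple (src (P (lhs c)) # ys)))"
      by (simp add: Q_def P_def \<omega>[OF C(1)[OF c] ys])
  qed (simp add: Q_def P_def)
  have "solution R (sat_pow k D) t"
    unfolding solution_sat_pow_iff[OF D]
  proof (intro conjI allI impI ballI)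
    show "t \<in> (\<Pi>\<^sub>E x\<in>Tuple ` tuples k (vars D). obs R (prod_set (map (vdom D) (entries x))))"
      using glue_mem[OF Pxs] unfolding codP by (auto simp: t_def)
  next
    fix cs assume cs: "length cs = k" "set cs \<subseteq> set (constrs D @ id_constrs D)"
    have ci: "cs ! i \<in> set (constrs D @ id_constrs D)" if "i < k" for i
      using that cs nth_mem by blast
    have tup: "map lhs cs \<in> tuples k (vars D)" "map rhs cs \<in> tuples k (vars D)"
      using cs C by (auto simp: tuples_def simp del: set_append)
    have Qs: "\<forall>p\<in>set (map Q cs). piece p" "length (map Q cs) = k" using cs Q by auto
    have "act R (prod_set (map cod (map P (map rhs cs)))) (prod_set (map cod (map Q cs)))
        (prod_map (map cod (map P (map rhs cs))) (map fn cs)) (glue (map P (map rhs cs))) = glue (map Q cs)"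
      using cs C[OF ci] by (intro glue_push Pxs[OF tup(2)] Qs) (auto simp: Q_def P_def compose_def)
    \<comment> \<open>The constraints enter here, exchanging each \<open>Q c\<close> for
      \<open>P (lhs c)\<close>; the previous equation is only functoriality.\<close>
    moreover have "glue (map Q cs) = glue (map P (map lhs cs))"
      using Q QP P C cs by (intro glue_cong) (auto simp: list_all2_conv_all_nth ci simp del: set_append)
    moreover have "map cod (map Q cs) = map (\<lambda>c. vdom D (lhs c)) cs" by (simp add: Q_def)
    ultimately show "t (Tuple (map lhs cs)) =
        act R (prod_set (map (\<lambda>c. vdom D (rhs c)) cs)) (prod_set (map (\<lambda>c. vdom D (lhs c)) cs))
          (prod_map (map (\<lambda>c. vdom D (rhs c)) cs) (map fn cs)) (t (Tuple (map rhs cs)))"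
      unfolding tT[OF tup(1)] tT[OF tup(2)] codP by (simp only: map_map o_def)
  next
    fix xs s assume xs: "xs \<in> tuples k (vars D)" and s: "length s = k" "set s \<subseteq> {0..<k}"
    have "map (\<lambda>i. map P xs ! i) s = map P (map (\<lambda>i. xs ! i) s)"
      using xs s by (auto simp: tuples_def)
    with glue_select[OF Pxs[OF xs] s]
    show "t (Tuple (map (\<lambda>i. xs ! i) s)) =
        act R (prod_set (map (vdom D) xs)) (prod_set (map (vdom D) (map (\<lambda>i. xs ! i) s)))
          (select_map (map (vdom D) xs) s) (t (Tuple xs))"
      unfolding tT[OF xs] tT[OF select_tuples[OF xs s]] by (simp only: codP)
  qed
  then show ?thesis by (rule exI[of _ t])
qed

theorem theorem3p3:
  fixes R :: "('a, 'r) minion" and D :: "'a lc" and k :: nat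
  assumes "is_minion R" and "k \<ge> 1" and "lc_instance D" and "lc_connected D"
  shows "(\<exists>r. solution R (sat_pow k D) r) \<longleftrightarrow> (\<exists>s. solution (lvl k R) D s)"
  using solution_lvl_if_solution_sat_pow[OF assms(1-3)] solution_sat_pow_if_solution_lvl[OF assms]
  by blast

end
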